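(* For every positive integer $n$, the ideal zeta function of the ring $R=\mathbb{Z}[t]/(t^n)$ satisfies \[ \zeta^I_{\mathbb{Z}[t]/(t^n)}(s)=\zeta(s)\,\zeta(2s-1)\,\zeta(3s-2)\cdots\zeta(ns-(n-1)), \] where $\zeta$ denotes the Riemann zeta function.
   Context: For a commutative ring $R$ with identity whose additive group is isomorphic to $\mathbb{Z}^n$, let $a^{\iota}_R(k)$ be the number of ideals $I$ of $R$ with $[R:I]=k$, and define the ideal zeta function $\zeta^I_R(s)=\sum_{k\ge 1} a^{\iota}_R(k)\,k^{-s}$ (a Dirichlet series, convergent in some right half-plane; the identity may be read as an identity of Dirichlet series). *)

theory Defs
  imports
    "HOL-Algebra.UnivPoly"
    "HOL-Algebra.IntRing"
    "HOL-Analysis.Complex_Transcendental"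
begin

text \<open>
  The index \<open>[R : I]\<close> is that of the additive group of \<open>I\<close> in the additive group
  of \<open>R\<close>. Since \<^const>\<open>card\<close> is \<open>0\<close> on infinite sets, ideals of infinite index are
  counted only at \<open>k = 0\<close>, which never enters the Dirichlet series.
\<close>

definition ideal_count :: "('a, 'm) ring_scheme \<Rightarrow> nat \<Rightarrow> nat" where
  "ideal_count R k = card {I. ideal I R \<and> card (a_rcosets\<^bsub>R\<^esub> I) = k}"

text \<open>The \<open>k\<close>-th term of the Dirichlet series, meant for \<open>k \<ge> 1\<close>.\<close>

definition ideal_zeta_term :: "('a, 'm) ring_scheme \<Rightarrow> complex \<Rightarrow> nat \<Rightarrow> complex" where
  "ideal_zeta_term R s k = of_nat (ideal_count R k) * of_nat k powr (- s)"

definition ideal_zeta :: "('a, 'm) ring_scheme \<Rightarrow> complex \<Rightarrow> complex" where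
  "ideal_zeta R s = (\<Sum>k. ideal_zeta_term R s (Suc k))"

text \<open>The defining series, which is the Riemann zeta function on \<open>Re s > 1\<close>.\<close>

definition riemann_zeta :: "complex \<Rightarrow> complex" where
  "riemann_zeta s = (\<Sum>k. of_nat (Suc k) powr (- s))"

definition truncated_poly_ring :: "nat \<Rightarrow> (nat \<Rightarrow> int) set ring" where
  "truncated_poly_ring n = UP \<Z> Quot (PIdl\<^bsub>UP \<Z>\<^esub> (up_ring.monom (UP \<Z>) 1 n))"

end

theory Submission
  imports
    Defs
    "HOL-Computational_Algebra.Polynomial"
    "HOL-Analysis.Infinite_Sum"
    "HOL-Analysis.Summation_Tests"
begin

text \<open>
  Ideals of \<open>\<int>[t]/(t\<^sup>n)\<close> are the ideals \<open>S\<close> of \<open>\<int>[X]\<close> containing \<open>X\<^sup>n\<close>. For such an \<open>S\<close> of finite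
  index let \<open>d(S) > 0\<close> generate the ideal of its constant coefficients and let
  \<open>J = (S : X)\<close>, which contains \<open>X\<^sup>n\<^sup>-\<^sup>1\<close> and \<open>S\<close> itself. Then \<open>[\<int>[X] : S] = d(S) [\<int>[X] : J]\<close>
  and \<open>S\<close> is generated over \<open>X J\<close> by some \<open>d(S) + X h \<in> J\<close>, where \<open>h\<close> is unique modulo \<open>J\<close>.
  So the \<open>S\<close> with given \<open>J\<close> and \<open>d(S) = d(J) e\<close> form a torsor under the kernel of multiplication by \<open>X\<close>
  on the finite group \<open>\<int>[X]/J\<close>; its order is that of the cokernel \<open>\<int>/d(J)\<close>, namely \<open>d(J)\<close>. The
  two-variable series \<open>F\<^sub>n(s,u) = \<Sum>\<^sub>S [\<int>[X] : S]\<^sup>-\<^sup>s d(S)\<^sup>-\<^sup>u\<close> hence satisfies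
  \<open>F\<^sub>n\<^sub>+\<^sub>1(s,u) = \<zeta>(s+u) F\<^sub>n(s, s+u-1)\<close>, and the theorem is the case \<open>u = 0\<close>.
\<close>

hide_const (open) up_ring.monom up_ring.coeff

subsection \<open>Ideals and their index\<close>

definition is_ideal :: "'a::comm_ring_1 set \<Rightarrow> bool" where
  "is_ideal S \<longleftrightarrow> 0 \<in> S \<and> (\<forall>f\<in>S. \<forall>g\<in>S. f + g \<in> S) \<and> (\<forall>r. \<forall>f\<in>S. r * f \<in> S)"

definition residue_class :: "'a::comm_ring_1 set \<Rightarrow> 'a \<Rightarrow> 'a set" where
  "residue_class S f = {g. g - f \<in> S}"

text \<open>The value is 0 exactly for infinite index, because \<open>card\<close> is 0 on infinite
  sets and the range is nonempty; so \<open>ideal_index S > 0\<close> expresses finite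
  index.\<close>

definition ideal_index :: "'a::comm_ring_1 set \<Rightarrow> nat" where
  "ideal_index S = card (range (residue_class S))"

lemma is_ideal_zero: "is_ideal S \<Longrightarrow> 0 \<in> S"
  and is_ideal_add: "is_ideal S \<Longrightarrow> f \<in> S \<Longrightarrow> g \<in> S \<Longrightarrow> f + g \<in> S"
  and is_ideal_mult: "is_ideal S \<Longrightarrow> f \<in> S \<Longrightarrow> r * f \<in> S"
  by (auto simp: is_ideal_def)

lemma is_ideal_uminus: "is_ideal S \<Longrightarrow> f \<in> S \<Longrightarrow> - f \<in> S"
  using is_ideal_mult[of S f "-1"] by simp

lemma is_ideal_diff: "is_ideal S \<Longrightarrow> f \<in> S \<Longrightarrow> g \<in> S \<Longrightarrow> f - g \<in> S"
  using is_ideal_add[of S f "- g"] is_ideal_uminus by fastforce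

lemma is_ideal_smult:
  fixes S :: "'a::comm_ring_1 poly set"
  shows "is_ideal S \<Longrightarrow> f \<in> S \<Longrightarrow> smult c f \<in> S"
  using is_ideal_mult[of S f "[:c:]"] by simp

lemma is_ideal_pCons_0:
  fixes S :: "'a::comm_ring_1 poly set"
  shows "is_ideal S \<Longrightarrow> f \<in> S \<Longrightarrow> pCons 0 f \<in> S"
  using is_ideal_mult[of S f "[:0, 1:]"] by simp

lemma residue_class_eq_iff:
  assumes "is_ideal S"
  shows "residue_class S f = residue_class S g \<longleftrightarrow> f - g \<in> S"
proof
  assume "residue_class S f = residue_class S g"
  moreover have "f \<in> residue_class S f"
    using assms by (simp add: residue_class_def is_ideal_zero)
  ultimately show "f - g \<in> S"
    by (simp add: residue_class_def)
next
  assume fg: "f - g \<in> S"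
  show "residue_class S f = residue_class S g"
    using is_ideal_add[OF assms _ fg] is_ideal_diff[OF assms _ fg]
    by (fastforce simp: residue_class_def)
qed

text \<open>Both images are in bijection with the classes of one equivalence relation on
  \<open>A\<close>. Counts of residue classes thereby become counts of explicit invariants, infinite
  images included.\<close>

lemma card_image_eq_if_same_fibres:
  assumes "\<And>x y. x \<in> A \<Longrightarrow> y \<in> A \<Longrightarrow> f x = f y \<longleftrightarrow> g x = g y"
  shows "card (f ` A) = card (g ` A)"
proof -
  have "bij_betw (\<lambda>b. g (inv_into A f b)) (f ` A) (g ` A)"
  proof (rule bij_betwI')
    fix x y assume "x \<in> f ` A" "y \<in> f ` A"
    then show "(g (inv_into A f x) = g (inv_into A f y)) = (x = y)"
      by (metis assms f_inv_into_f inv_into_into)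
  next
    fix x assume "x \<in> f ` A"
    then show "g (inv_into A f x) \<in> g ` A" by (simp add: inv_into_into)
  next
    fix y assume "y \<in> g ` A"
    then obtain a where a: "a \<in> A" "y = g a" by auto
    then have "g (inv_into A f (f a)) = g a"
      by (metis assms f_inv_into_f imageI inv_into_into)
    then show "\<exists>x\<in>f ` A. y = g (inv_into A f x)" using a by (intro bexI[of _ "f a"]) auto
  qed
  then show ?thesis by (rule bij_betw_same_card)
qed

text \<open>Multiplicativity of the index in a tower, the last factor being \<open>[T : S]\<close>.
  Once a representative \<open>r f\<close> is fixed in each class modulo \<open>T\<close>, the class
  of \<open>f\<close> modulo \<open>S\<close> amounts to its class modulo \<open>T\<close> together
  with \<open>f - r f \<in> T\<close> modulo \<open>S\<close>.\<close>

lemma ideal_index_subset: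
  assumes S: "is_ideal S" and T: "is_ideal T" and "S \<subseteq> T"
  shows "ideal_index S = ideal_index T * card (residue_class S ` T)"
proof -
  define r where "r f = (SOME g. g \<in> residue_class T f)" for f
  have r: "r f - f \<in> T" for f
  proof -
    have "f \<in> residue_class T f" using T by (simp add: residue_class_def is_ideal_zero)
    then have "r f \<in> residue_class T f" unfolding r_def by (rule someI)
    then show ?thesis by (simp add: residue_class_def)
  qed
  have r_cong: "residue_class T f = residue_class T g \<Longrightarrow> r f = r g" for f g
    by (simp add: r_def)
  let ?h = "\<lambda>f. (residue_class T f, residue_class S (f - r f))"
  have "card (range (residue_class S)) = card (range ?h)"
  proof (rule card_image_eq_if_same_fibres)
    fix f g
    have "f - g \<in> S \<Longrightarrow> residue_class T f = residue_class T g"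
      using \<open>S \<subseteq> T\<close> by (auto simp: residue_class_eq_iff[OF T])
    then show "residue_class S f = residue_class S g \<longleftrightarrow> ?h f = ?h g"
      using r_cong[of f g] by (auto simp: residue_class_eq_iff[OF S])
  qed
  also have "range ?h = range (residue_class T) \<times> residue_class S ` T"
  proof safe
    fix f show "residue_class S (f - r f) \<in> residue_class S ` T"
      using is_ideal_uminus[OF T r[of f]] by auto
  next
    fix f t assume t: "t \<in> T"
    \<comment> \<open>The pair given by \<open>f\<close> and \<open>t\<close> is attained at
      \<open>r f + t\<close>: adding \<open>t \<in> T\<close> changes neither the class modulo
      \<open>T\<close> nor its representative.\<close>
    have 1: "residue_class T (r f + t) = residue_class T f"
      using is_ideal_add[OF T r[of f] t] by (simp add: residue_class_eq_iff[OF T] algebra_simps)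
    then have "r (r f + t) = r f" by (rule r_cong)
    with 1 have "?h (r f + t) = (residue_class T f, residue_class S t)" by simp
    then show "(residue_class T f, residue_class S t) \<in> range ?h" by (intro range_eqI[OF sym])
  qed auto
  finally show ?thesis by (simp add: ideal_index_def card_cartesian_product)
qed

subsection \<open>Finite-index ideals of integer polynomials\<close>

definition colon_X :: "int poly set \<Rightarrow> int poly set" where
  "colon_X S = {h. pCons 0 h \<in> S}"

text \<open>The \<open>LEAST\<close> is junk when all constant coefficients of \<open>S\<close> vanish; finite index excludes this.\<close>

definition const_gen :: "int poly set \<Rightarrow> nat" where
  "const_gen S = (LEAST d. d > 0 \<and> (\<exists>f\<in>S. coeff f 0 = int d))"

lemma is_ideal_colon_X:
  assumes "is_ideal S"
  shows "is_ideal (colon_X S)"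
  unfolding is_ideal_def colon_X_def
proof (intro conjI ballI allI; clarify?)
  show "pCons 0 0 \<in> S" using is_ideal_zero[OF assms] by simp
next
  fix f g assume "pCons 0 f \<in> S" "pCons 0 g \<in> S"
  from is_ideal_add[OF assms this] show "pCons 0 (f + g) \<in> S" by simp
next
  fix r f assume "pCons 0 f \<in> S"
  from is_ideal_mult[OF assms this, of r] show "pCons 0 (r * f) \<in> S" by simp
qed

lemma subset_colon_X: "is_ideal S \<Longrightarrow> S \<subseteq> colon_X S"
  using is_ideal_pCons_0 by (auto simp: colon_X_def)

text \<open>Division with remainder: reducing \<open>f\<close> by a \<open>g \<in> S\<close> that
  attains the least positive constant coefficient leaves a remainder whose constant coefficient is
  smaller, hence 0 by minimality.\<close>

lemma const_gen_dvd:
  assumes S: "is_ideal S" and f: "f \<in> S"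
  shows "int (const_gen S) dvd coeff f 0"
  and const_gen_pos: "coeff f 0 \<noteq> 0 \<Longrightarrow> const_gen S > 0"
  and const_gen_attained: "coeff f 0 \<noteq> 0 \<Longrightarrow> \<exists>g\<in>S. coeff g 0 = int (const_gen S)"
proof -
  define P where "P d \<longleftrightarrow> d > 0 \<and> (\<exists>f\<in>S. coeff f 0 = int d)" for d
  have gen: "P (const_gen S) \<and> int (const_gen S) dvd coeff f 0" if "coeff f 0 \<noteq> 0"
  proof -
    \<comment> \<open>Either \<open>f\<close> or \<open>- f\<close> has a positive constant
      coefficient, so the \<open>LEAST\<close> is taken over a nonempty set.\<close>
    have "P (nat \<bar>coeff f 0\<bar>)"
      using that f is_ideal_uminus[OF S f] unfolding P_def
      by (cases "coeff f 0 > 0") (auto intro: bexI[of _ f] bexI[of _ "- f"])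
    then have P: "P (const_gen S)"
      unfolding const_gen_def P_def[symmetric] by (rule LeastI)
    then obtain g where g: "g \<in> S" "coeff g 0 = int (const_gen S)" by (auto simp: P_def)
    define q where "q = f - smult (coeff f 0 div int (const_gen S)) g"
    have q: "q \<in> S" "coeff q 0 = coeff f 0 mod int (const_gen S)"
      using S f g by (auto simp: q_def is_ideal_diff is_ideal_smult minus_div_mult_eq_mod)
    have "coeff q 0 = 0"
    proof (rule ccontr)
      assume "coeff q 0 \<noteq> 0"
      moreover from P have "const_gen S > 0" by (simp add: P_def)
      ultimately have "coeff q 0 > 0" "coeff q 0 < int (const_gen S)"
        using pos_mod_sign[of "int (const_gen S)" "coeff f 0"] pos_mod_bound[of "int (const_gen S)" "coeff f 0"]
        unfolding q(2) by linarith+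
      then have "P (nat (coeff q 0))" "nat (coeff q 0) < const_gen S"
        using q(1) by (auto simp: P_def)
      then show False
        using not_less_Least[of "nat (coeff q 0)" P] unfolding const_gen_def P_def[symmetric] by simp
    qed
    with q(2) P show ?thesis by auto
  qed
  then show "int (const_gen S) dvd coeff f 0" by (cases "coeff f 0 = 0") auto
  show "coeff f 0 \<noteq> 0 \<Longrightarrow> const_gen S > 0"
    and "coeff f 0 \<noteq> 0 \<Longrightarrow> \<exists>g\<in>S. coeff g 0 = int (const_gen S)"
    using gen by (auto simp: P_def)
qed

lemma const_gen_eqI:
  assumes "is_ideal S" "f \<in> S" "coeff f 0 = int d" "d > 0" "\<And>g. g \<in> S \<Longrightarrow> int d dvd coeff g 0"
  shows "const_gen S = d"
proof -
  have "int (const_gen S) dvd int d" using const_gen_dvd[OF assms(1,2)] assms(3) by simp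
  moreover obtain g where "g \<in> S" "coeff g 0 = int (const_gen S)"
    using const_gen_attained[OF assms(1,2)] assms(3,4) by auto
  then have "int d dvd int (const_gen S)" using assms(5) by metis
  ultimately show ?thesis by (simp add: dvd_antisym)
qed

text \<open>Pigeonhole: the infinitely many integer constants meet only finitely many residue
  classes, and the difference of two congruent ones is a nonzero constant in
  \<open>S\<close>.\<close>

lemma finite_index_const_coeff:
  fixes S :: "int poly set"
  assumes S: "is_ideal S" and pos: "ideal_index S > 0"
  shows "\<exists>f\<in>S. coeff f 0 \<noteq> 0"
proof -
  have "finite (range (residue_class S))"
    using pos by (auto simp: ideal_index_def intro: card_ge_0_finite)
  then have "finite (range (\<lambda>c::int. residue_class S [:c:]))"
    by (rule finite_subset[rotated]) auto
  then have "\<not> inj (\<lambda>c::int. residue_class S [:c:])"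
    using finite_imageD infinite_UNIV_int by blast
  then obtain a b :: int where "a \<noteq> b" "[:a:] - [:b:] \<in> S"
    by (auto simp: inj_def residue_class_eq_iff[OF S])
  then show ?thesis by (intro bexI[of _ "[:a:] - [:b:]"]) auto
qed

text \<open>Subtracting an integer multiple of \<open>g \<in> S\<close> with constant coefficient
  \<open>d\<close> brings each \<open>p\<close> to the form \<open>a + X t\<close> with
  \<open>0 \<le> a < d\<close>. Then \<open>a\<close> and the class of \<open>t\<close> modulo
  \<open>colon_X S\<close> are independent and determine the class of \<open>p\<close> modulo
  \<open>S\<close>.\<close>

lemma ideal_index_eq_const_gen_mult:
  assumes S: "is_ideal S" and f: "f \<in> S" "coeff f 0 \<noteq> 0"
  shows "ideal_index S = const_gen S * ideal_index (colon_X S)"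
proof -
  define d where "d = int (const_gen S)"
  have d: "d > 0" using const_gen_pos[OF S f] by (simp add: d_def)
  obtain g where g: "g \<in> S" "coeff g 0 = d"
    using const_gen_attained[OF S f] by (auto simp: d_def)
  have dvd: "h \<in> S \<Longrightarrow> d dvd coeff h 0" for h
    using const_gen_dvd[OF S] by (simp add: d_def)
  define q where "q p = p - smult (coeff p 0 div d) g" for p
  define t where "t p = poly_shift 1 (q p)" for p
  have q0: "coeff (q p) 0 = coeff p 0 mod d" for p
    by (simp add: q_def g minus_div_mult_eq_mod)
  have qt: "q p = pCons (coeff p 0 mod d) (t p)" for p
    by (rule poly_eqI) (simp add: t_def q0 coeff_pCons coeff_poly_shift split: nat.split)
  have q_cong: "q p - q p' \<in> S \<longleftrightarrow> p - p' \<in> S" for p p'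
  proof -
    have *: "smult c g \<in> S" for c using S g by (simp add: is_ideal_smult)
    have "q p - q p' = (p - p') - smult (coeff p 0 div d - coeff p' 0 div d) g"
      by (simp add: q_def smult_diff_left)
    moreover have "p - p' = (q p - q p') + smult (coeff p 0 div d - coeff p' 0 div d) g"
      by (simp add: q_def smult_diff_left)
    ultimately show ?thesis
      using is_ideal_add[OF S _ *] is_ideal_diff[OF S _ *] by metis
  qed
  let ?h = "\<lambda>p. (coeff p 0 mod d, residue_class (colon_X S) (t p))"
  have "card (range (residue_class S)) = card (range ?h)"
  proof (rule card_image_eq_if_same_fibres)
    fix p p'
    have "q p - q p' \<in> S \<longleftrightarrow> coeff p 0 mod d = coeff p' 0 mod d \<and> t p - t p' \<in> colon_X S"
    proof -
      have "coeff p 0 mod d = coeff p' 0 mod d" if "q p - q p' \<in> S"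
      proof -
        from dvd[OF that] have "d dvd coeff p 0 mod d - coeff p' 0 mod d"
          unfolding coeff_diff q0 .
        then show ?thesis
          by (simp flip: mod_eq_dvd_iff)
      qed
      then show ?thesis by (auto simp: qt colon_X_def)
    qed
    then show "residue_class S p = residue_class S p' \<longleftrightarrow> ?h p = ?h p'"
      by (simp add: residue_class_eq_iff S is_ideal_colon_X q_cong)
  qed
  also have "range ?h = {0..<d} \<times> range (residue_class (colon_X S))"
  proof safe
    fix a :: int and h :: "int poly" assume "a \<in> {0..<d}"
    \<comment> \<open>Since \<open>a div d = 0\<close>, this polynomial is already reduced, so every
      pair of invariants occurs.\<close>
    then have "q (pCons a h) = pCons a h" by (simp add: q_def)
    then have "?h (pCons a h) = (a, residue_class (colon_X S) h)"
      using qt[of "pCons a h"] \<open>a \<in> {0..<d}\<close> by simp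
    then show "(a, residue_class (colon_X S) h) \<in> range ?h" by (intro range_eqI[OF sym])
  next
    fix p show "coeff p 0 mod d \<in> {0..<d}" using d by simp
  qed simp
  finally show ?thesis by (simp add: ideal_index_def card_cartesian_product d_def)
qed

text \<open>The left side is the order of the kernel of \<open>X\<close> on the quotient by
  \<open>J\<close>. The index of \<open>J\<close> is computed twice, through the tower
  \<open>J \<subseteq> colon_X J\<close> and through the constant coefficients; the common finite
  factor \<open>ideal_index (colon_X J)\<close> cancels.\<close>

lemma card_ann_X_quotient:
  assumes J: "is_ideal J" and pos: "ideal_index J > 0"
  shows "card (residue_class J ` colon_X J) = const_gen J"
proof -
  obtain f where f: "f \<in> J" "coeff f 0 \<noteq> 0" using finite_index_const_coeff[OF assms] by auto
  have "ideal_index (colon_X J) * const_gen J = ideal_index (colon_X J) * card (residue_class J ` colon_X J)"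
    using ideal_index_eq_const_gen_mult[OF J f]
      ideal_index_subset[OF J is_ideal_colon_X[OF J] subset_colon_X[OF J]]
    by (metis mult.commute)
  moreover have "ideal_index (colon_X J) > 0"
    using ideal_index_eq_const_gen_mult[OF J f] pos by (metis gr0I mult_0_right)
  ultimately show ?thesis by simp
qed

section \<open>Ideals with a prescribed colon ideal\<close>

definition extend_ideal :: "int poly set \<Rightarrow> int poly \<Rightarrow> int poly set" where
  "extend_ideal J f = {smult m f + pCons 0 g | m g. g \<in> J}"

lemma is_ideal_extend_ideal:
  assumes J: "is_ideal J" and f: "f \<in> J"
  shows "is_ideal (extend_ideal J f)"
  unfolding is_ideal_def
proof (intro conjI ballI allI)
  show "0 \<in> extend_ideal J f"
    unfolding extend_ideal_def using is_ideal_zero[OF J] by (force intro: exI[of _ 0])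
next
  fix a b assume "a \<in> extend_ideal J f" "b \<in> extend_ideal J f"
  then obtain m g m' g' where "g \<in> J" "g' \<in> J" 
    "a = smult m f + pCons 0 g" "b = smult m' f + pCons 0 g'"
    by (auto simp: extend_ideal_def)
  then have "a + b = smult (m + m') f + pCons 0 (g + g') \<and> g + g' \<in> J"
    by (simp add: smult_add_left is_ideal_add[OF J] flip: add_pCons) (simp add: algebra_simps)
  then show "a + b \<in> extend_ideal J f" unfolding extend_ideal_def by blast
next
  fix r a :: "int poly" assume "a \<in> extend_ideal J f"
  then obtain m g where a: "g \<in> J" "a = smult m f + pCons 0 g"
    by (auto simp: extend_ideal_def)
  have aJ: "a \<in> J" using a f by (auto intro!: is_ideal_add is_ideal_smult is_ideal_pCons_0 J)
  obtain c p where r: "r = pCons c p" by (cases r)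
  \<comment> \<open>With \<open>r = c + X p\<close>, the part \<open>X p a\<close> lies in
    \<open>X J\<close> because \<open>a \<in> J\<close>; this is why integer multiples of
    \<open>f\<close> suffice as generators over \<open>X J\<close>.\<close>
  have "r * a = smult (c * m) f + pCons 0 (smult c g + p * a)"
    by (simp add: r a(2) smult_add_right algebra_simps)
  moreover have "smult c g + p * a \<in> J"
    using aJ a by (auto intro!: is_ideal_add is_ideal_smult is_ideal_mult J)
  ultimately show "r * a \<in> extend_ideal J f" unfolding extend_ideal_def by blast
qed

text \<open>The preimages in \<open>\<int>[X]\<close> of the finite-index ideals of the truncated
  ring.\<close>

definition trunc_ideals :: "nat \<Rightarrow> int poly set set" where
  "trunc_ideals n = {S. is_ideal S \<and> monom 1 n \<in> S \<and> ideal_index S > 0}"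

text \<open>These facts make \<open>S\<close> determine a pair \<open>(J, e)\<close> with
  \<open>J = colon_X S\<close> and \<open>const_gen S = const_gen J * e\<close>. The divisibility
  comes from \<open>S \<subseteq> colon_X S\<close>.\<close>

lemma trunc_ideals_Suc:
  assumes "S \<in> trunc_ideals (Suc n)"
  shows colon_X_trunc_ideals: "colon_X S \<in> trunc_ideals n"
    and const_gen_colon_X_dvd: "const_gen (colon_X S) dvd const_gen S"
    and ideal_index_trunc_Suc: "ideal_index S = const_gen S * ideal_index (colon_X S)"
proof -
  have S: "is_ideal S" "monom 1 (Suc n) \<in> S" "ideal_index S > 0"
    using assms by (auto simp: trunc_ideals_def)
  obtain f where f: "f \<in> S" "coeff f 0 \<noteq> 0" using finite_index_const_coeff[OF S(1,3)] by auto
  show idx: "ideal_index S = const_gen S * ideal_index (colon_X S)"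
    by (rule ideal_index_eq_const_gen_mult[OF S(1) f])
  then have "ideal_index (colon_X S) > 0"
    using S(3) by (metis gr0I mult_0_right)
  then show "colon_X S \<in> trunc_ideals n"
    using S is_ideal_colon_X[OF S(1)] by (auto simp: trunc_ideals_def colon_X_def monom_Suc)
  obtain g where g: "g \<in> S" "coeff g 0 = int (const_gen S)"
    using const_gen_attained[OF S(1) f] by auto
  have "g \<in> colon_X S" using subset_colon_X[OF S(1)] g by auto
  from const_gen_dvd[OF is_ideal_colon_X[OF S(1)] this]
  show "const_gen (colon_X S) dvd const_gen S" using g by simp
qed

lemma const_gen_trunc_pos: "S \<in> trunc_ideals n \<Longrightarrow> const_gen S > 0"
  using finite_index_const_coeff const_gen_pos by (auto simp: trunc_ideals_def)

lemma ideal_index_UNIV: "ideal_index (UNIV :: int poly set) = 1"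
proof -
  have "residue_class UNIV = (\<lambda>_. UNIV :: int poly set)"
    by (auto simp: residue_class_def)
  then show ?thesis by (simp add: ideal_index_def)
qed

text \<open>Base case of the induction: \<open>X^0 = 1\<close> forces the unit ideal.\<close>

lemma trunc_ideals_0: "trunc_ideals 0 = {UNIV}"
proof -
  have "S = UNIV" if "is_ideal S" "1 \<in> S" for S :: "int poly set"
    using is_ideal_mult[OF that] by auto
  moreover have "is_ideal (UNIV :: int poly set)" by (simp add: is_ideal_def)
  ultimately show ?thesis
    unfolding trunc_ideals_def monom_0 one_pCons[symmetric] using ideal_index_UNIV by fastforce
qed

lemma const_gen_UNIV: "const_gen UNIV = 1"
  by (rule const_gen_eqI[of _ 1]) (auto simp: is_ideal_def)

text \<open>Each such \<open>S\<close> has the form \<open>extend_ideal J (d + X h)\<close>, where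
  \<open>d + X h\<close> lies in \<open>J\<close> and \<open>h\<close> matters only modulo
  \<open>J\<close>. The admissible \<open>h\<close> form a coset of \<open>colon_X J\<close>, so the
  count is the order of the kernel of \<open>X\<close> and does not depend on
  \<open>e\<close>.\<close>

lemma card_extensions:
  assumes J: "J \<in> trunc_ideals n" and e: "e > 0"
  shows "card {S \<in> trunc_ideals (Suc n). colon_X S = J \<and> const_gen S = const_gen J * e} = const_gen J"
proof -
  have JI: "is_ideal J" "monom 1 n \<in> J" "ideal_index J > 0"
    using J by (auto simp: trunc_ideals_def)
  define d where "d = const_gen J * e"
  have d: "d > 0" using const_gen_trunc_pos[OF J] e by (simp add: d_def)
  define H where "H = {h. pCons (int d) h \<in> J}"
  let ?E = "\<lambda>h. extend_ideal J (pCons (int d) h)"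
  have ext: "is_ideal (?E h)" "colon_X (?E h) = J" "const_gen (?E h) = d" "pCons (int d) h \<in> ?E h"
    if h: "h \<in> H" for h
  proof -
    let ?f = "pCons (int d) h"
    show id: "is_ideal (?E h)" using h by (intro is_ideal_extend_ideal JI) (simp add: H_def)
    show "colon_X (?E h) = J"
    proof safe
      fix p assume "p \<in> colon_X (?E h)"
      then obtain m g where "g \<in> J" "pCons 0 p = smult m ?f + pCons 0 g"
        by (auto simp: colon_X_def extend_ideal_def)
      \<comment> \<open>Constant coefficients give \<open>m * d = 0\<close>, so \<open>m = 0\<close>
        and \<open>p = g\<close>.\<close>
      then show "p \<in> J" using d by auto
    next
      fix p assume "p \<in> J"
      moreover have "pCons 0 p = smult 0 ?f + pCons 0 p" by simp
      ultimately show "p \<in> colon_X (?E h)"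
        unfolding colon_X_def extend_ideal_def by blast
    qed
    have "?f = smult 1 ?f + pCons 0 0" by simp
    then show f: "?f \<in> ?E h"
      using is_ideal_zero[OF JI(1)] unfolding extend_ideal_def by blast
    show "const_gen (?E h) = d"
      by (rule const_gen_eqI[OF id f _ d]) (auto simp: extend_ideal_def)
  qed
  have eq_ext: "S = ?E h" 
    if S: "is_ideal S" "colon_X S = J" "const_gen S = d" "pCons (int d) h \<in> S" for S h
  proof safe
    fix p assume p: "p \<in> S"
    \<comment> \<open>Subtracting \<open>m\<close> times the generator removes the constant
      coefficient of \<open>p\<close>; what remains is \<open>X g\<close> with
      \<open>g \<in> colon_X S = J\<close>.\<close>
    obtain m where m: "coeff p 0 = m * int d"
      using const_gen_dvd[OF S(1) p] S(3) by (auto simp: dvd_def mult.commute)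
    define g where "g = poly_shift 1 (p - smult m (pCons (int d) h))"
    have eq: "p - smult m (pCons (int d) h) = pCons 0 g"
      by (rule poly_eqI) (auto simp: g_def coeff_pCons coeff_poly_shift m split: nat.split)
    then have "g \<in> J"
      using is_ideal_diff[OF S(1) p is_ideal_smult[OF S(1,4), of m]] unfolding S(2)[symmetric] colon_X_def
      by simp
    moreover have "p = smult m (pCons (int d) h) + pCons 0 g" using eq by (simp add: algebra_simps)
    ultimately show "p \<in> ?E h" unfolding extend_ideal_def by blast
  next
    fix p assume "p \<in> ?E h"
    then obtain m g where g: "g \<in> J" "p = smult m (pCons (int d) h) + pCons 0 g"
      by (auto simp: extend_ideal_def)
    from g(1) have "pCons 0 g \<in> S" by (simp add: colon_X_def flip: S(2))
    then show "p \<in> S"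
      unfolding g(2) by (intro is_ideal_add is_ideal_smult S)
  qed
  have "{S \<in> trunc_ideals (Suc n). colon_X S = J \<and> const_gen S = d} = ?E ` H"
  proof (intro equalityI subsetI)
    fix S assume "S \<in> {S \<in> trunc_ideals (Suc n). colon_X S = J \<and> const_gen S = d}"
    then have S: "S \<in> trunc_ideals (Suc n)" "const_gen S = d" "J = colon_X S" by auto
    then have SI: "is_ideal S" "ideal_index S > 0" by (auto simp: trunc_ideals_def)
    obtain f where f: "f \<in> S" "coeff f 0 = int d"
      using finite_index_const_coeff[OF SI] const_gen_attained[OF SI(1)] S(2) by metis
    obtain h where h: "f = pCons (int d) h" using f(2) by (cases f) auto
    have "h \<in> H" using f subset_colon_X[OF SI(1)] by (auto simp: H_def h S(3))
    moreover have "S = ?E h" using SI S f h by (intro eq_ext) auto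
    ultimately show "S \<in> ?E ` H" by blast
  next
    fix S assume "S \<in> ?E ` H"
    then obtain h where h: "h \<in> H" and Sh: "S = ?E h" by blast
    have "monom 1 n \<in> colon_X (?E h)" using ext(2)[OF h] JI by simp
    moreover have "ideal_index (?E h) = d * ideal_index J"
      using ideal_index_eq_const_gen_mult[OF ext(1,4)[OF h]] ext[OF h] d by simp
    ultimately have "?E h \<in> trunc_ideals (Suc n)"
      using ext(1)[OF h] d JI by (simp add: trunc_ideals_def colon_X_def monom_Suc)
    then show "S \<in> {S \<in> trunc_ideals (Suc n). colon_X S = J \<and> const_gen S = d}"
      using ext(2,3)[OF h] by (simp add: Sh)
  qed
  also have "card (?E ` H) = card (residue_class J ` H)"
  proof (rule card_image_eq_if_same_fibres)
    fix h h' assume H: "h \<in> H" "h' \<in> H"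
    show "?E h = ?E h' \<longleftrightarrow> residue_class J h = residue_class J h'"
      unfolding residue_class_eq_iff[OF JI(1)]
    proof
      assume "?E h = ?E h'"
      then have "pCons (int d) h' \<in> ?E h" using ext(4)[OF H(2)] by simp
      from is_ideal_diff[OF ext(1)[OF H(1)] ext(4)[OF H(1)] this]
      have "h - h' \<in> colon_X (?E h)" by (simp add: colon_X_def)
      then show "h - h' \<in> J" using ext(2)[OF H(1)] by simp
    next
      assume "h - h' \<in> J"
      then have "pCons 0 (h - h') \<in> ?E h'" using ext(2)[OF H(2)] by (auto simp: colon_X_def)
      from is_ideal_add[OF ext(1)[OF H(2)] this ext(4)[OF H(2)]]
      have "pCons (int d) h \<in> ?E h'" by simp
      then show "?E h = ?E h'" using eq_ext[OF ext(1-3)[OF H(2)]] by simp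
    qed
  qed
  also have "card (residue_class J ` H) = card (residue_class J ` colon_X J)"
  proof -
    \<comment> \<open>Multiplying an \<open>f\<close> that attains \<open>const_gen J\<close> by
      \<open>e\<close> gives an element of \<open>J\<close> with constant coefficient
      \<open>d\<close>. Its tail is a base point of \<open>H\<close>, making \<open>H\<close> a
      translate of \<open>colon_X J\<close>.\<close>
    obtain f where f: "f \<in> J" "coeff f 0 = int (const_gen J)"
      using finite_index_const_coeff[OF JI(1,3)] const_gen_attained[OF JI(1)] by metis
    obtain h\<^sub>0 where h0: "smult (int e) f = pCons (int d) h\<^sub>0"
      using f(2) by (cases f) (auto simp: d_def)
    have h0J: "pCons (int d) h\<^sub>0 \<in> J" using is_ideal_smult[OF JI(1) f(1)] h0 by metis
    have "H = (\<lambda>k. k + h\<^sub>0) ` colon_X J"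
    proof safe
      fix h assume "h \<in> H"
      then have "h - h\<^sub>0 \<in> colon_X J" 
        using is_ideal_diff[OF JI(1) _ h0J] by (fastforce simp: H_def colon_X_def)
      then show "h \<in> (\<lambda>k. k + h\<^sub>0) ` colon_X J" by (intro image_eqI[of _ _ "h - h\<^sub>0"]) auto
    next
      fix k assume "k \<in> colon_X J"
      then show "k + h\<^sub>0 \<in> H"
        using is_ideal_add[OF JI(1) _ h0J] by (fastforce simp: H_def colon_X_def)
    qed
    then have "card (residue_class J ` H) = card ((\<lambda>k. residue_class J (k + h\<^sub>0)) ` colon_X J)"
      by (simp add: image_image)
    also have "\<dots> = card (residue_class J ` colon_X J)"
      by (rule card_image_eq_if_same_fibres) (simp add: residue_class_eq_iff[OF JI(1)])
    finally show ?thesis .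
  qed
  also have "\<dots> = const_gen J" by (rule card_ann_X_quotient[OF JI(1,3)])
  finally show ?thesis by (simp add: d_def)
qed

subsection \<open>The Dirichlet series\<close>

lemma bij_betw_snd_fibres:
  assumes "\<And>x. x \<in> A \<Longrightarrow> p x \<in> B"
  shows "bij_betw snd (SIGMA y:B. {x \<in> A. p x = y}) A"
  using assms by (auto simp: bij_betw_def inj_on_def image_iff)

text \<open>The summand is constant on the finite fibres of \<open>p\<close>. Summing norms
  fibrewise gives absolute convergence over \<open>A\<close>, which then justifies regrouping the
  sum itself.\<close>

lemma has_sum_fibres:
  fixes f :: "'b \<Rightarrow> 'c::banach"
  assumes p: "\<And>x. x \<in> A \<Longrightarrow> p x \<in> B"
    and fin: "\<And>y. y \<in> B \<Longrightarrow> finite {x \<in> A. p x = y}"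
    and abs: "(\<lambda>y. of_nat (card {x \<in> A. p x = y}) * norm (f y)) summable_on B"
    and sum: "((\<lambda>y. \<Sum>x\<in>{x \<in> A. p x = y}. f y) has_sum z) B"
  shows "(\<lambda>x. f (p x)) abs_summable_on A" "((\<lambda>x. f (p x)) has_sum z) A"
proof -
  let ?D = "SIGMA y:B. {x \<in> A. p x = y}"
  have "(\<lambda>yx. norm (f (p (snd yx)))) summable_on ?D"
  proof (rule summable_on_SigmaI[OF _ abs])
    fix y assume y: "y \<in> B"
    show "((\<lambda>x. norm (f (p (snd (y, x))))) has_sum of_nat (card {x \<in> A. p x = y}) * norm (f y)) {x \<in> A. p x = y}"
      using fin[OF y] by (intro has_sum_finiteI) auto
  qed auto
  then show *: "(\<lambda>x. f (p x)) abs_summable_on A"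
    using summable_on_reindex_bij_betw[OF bij_betw_snd_fibres[OF p], where f = "\<lambda>x. norm (f (p x))"] by simp
  from abs_summable_summable[OF this] have smD: "(\<lambda>yx. f (p (snd yx))) summable_on ?D"
    using summable_on_reindex_bij_betw[OF bij_betw_snd_fibres[OF p], where f = "\<lambda>x. f (p x)"] by simp
  have "((\<lambda>yx. f (p (snd yx))) has_sum z) ?D"
  proof (rule has_sum_SigmaI[OF _ sum smD])
    fix y assume y: "y \<in> B"
    show "((\<lambda>x. f (p (snd (y, x)))) has_sum (\<Sum>x\<in>{x \<in> A. p x = y}. f y)) {x \<in> A. p x = y}"
      using fin[OF y] by (intro has_sum_finiteI) auto
  qed
  then show "((\<lambda>x. f (p x)) has_sum z) A"
    using has_sum_reindex_bij_betw[OF bij_betw_snd_fibres[OF p], where f = "\<lambda>x. f (p x)"] by simp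
qed

lemma has_sum_Times_mult:
  fixes f :: "'a \<Rightarrow> 'c::{real_normed_field,banach}"
  assumes "f abs_summable_on A" "g abs_summable_on B" "(f has_sum a) A" "(g has_sum b) B"
  shows "(\<lambda>(x, y). f x * g y) abs_summable_on A \<times> B"
    and "((\<lambda>(x, y). f x * g y) has_sum a * b) (A \<times> B)"
proof -
  obtain b' where b': "((\<lambda>y. norm (g y)) has_sum b') B" using assms(2) by (auto simp: summable_on_def)
  show abs: "(\<lambda>(x, y). f x * g y) abs_summable_on A \<times> B"
  proof (rule summable_on_SigmaI)
    show "(\<lambda>x. norm (f x) * b') summable_on A" by (intro summable_on_cmult_left assms)
    show "((\<lambda>y. norm (case (x, y) of (x, y) \<Rightarrow> f x * g y)) has_sum norm (f x) * b') B" for x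
      using has_sum_cmult_right[OF b', of "norm (f x)"] by (simp add: norm_mult)
  qed auto
  show "((\<lambda>(x, y). f x * g y) has_sum a * b) (A \<times> B)"
  proof (rule has_sum_SigmaI)
    show "((\<lambda>x. f x * b) has_sum a * b) A" by (intro has_sum_cmult_left assms)
    show "((\<lambda>y. case (x, y) of (x, y) \<Rightarrow> f x * g y) has_sum f x * b) B" for x
      using has_sum_cmult_right[OF assms(4), of "f x"] by simp
  qed (rule abs_summable_summable[OF abs])
qed

lemma has_sum_riemann_zeta:
  assumes "Re z > 1"
  shows "(\<lambda>e. of_nat e powr (- z) :: complex) abs_summable_on {0<..}"
    and "((\<lambda>e. of_nat e powr (- z)) has_sum riemann_zeta z) {0<..}"
proof -
  have bij: "bij_betw Suc UNIV {0<..}"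
    by (auto simp: bij_betw_def image_iff gr0_conv_Suc)
  have "summable (\<lambda>n. real n powr (- Re z))" using assms by (simp add: summable_real_powr_iff)
  then have "summable (\<lambda>n. real (Suc n) powr (- Re z))" by (subst summable_Suc_iff)
  moreover have "norm (of_nat (Suc n) powr (- z)) = real (Suc n) powr (- Re z)" for n
    by (subst norm_powr_real_powr) (simp_all del: of_nat_Suc)
  ultimately have sm: "summable (\<lambda>n. norm (of_nat (Suc n) powr (- z)))"
    by (simp del: of_nat_Suc)
  show "(\<lambda>e. of_nat e powr (- z) :: complex) abs_summable_on {0<..}"
    using summable_on_reindex_bij_betw[OF bij, where f = "\<lambda>e. norm (of_nat e powr (- z))"]
      summable_nonneg_imp_summable_on[OF sm] by simp
  have "((\<lambda>k. of_nat (Suc k) powr (- z)) has_sum riemann_zeta z) UNIV"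
    unfolding riemann_zeta_def
    by (rule norm_summable_imp_has_sum[OF sm summable_sums[OF summable_norm_cancel[OF sm]]])
  then show "((\<lambda>e. of_nat e powr (- z)) has_sum riemann_zeta z) {0<..}"
    using has_sum_reindex_bij_betw[OF bij, where f = "\<lambda>e. of_nat e powr (- z)"] by simp
qed

section \<open>The two-variable series and its recursion\<close>

lemma of_nat_mult_powr: "(of_nat (a * b) :: complex) powr z = of_nat a powr z * of_nat b powr z"
  by (simp add: powr_times_real)

text \<open>The summand of the series in \<open>s\<close> and \<open>u\<close>. The variable
  \<open>u\<close> records the constant-coefficient generator, which the recursion needs;
  \<open>u = 0\<close> recovers the ideal zeta function.\<close>

definition zeta_weight :: "complex \<Rightarrow> complex \<Rightarrow> int poly set \<Rightarrow> complex" where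
  "zeta_weight s u S = of_nat (ideal_index S) powr (- s) * of_nat (const_gen S) powr (- u)"

text \<open>Here \<open>d\<close> and \<open>k\<close> stand for generator and index of
  \<open>J\<close>, and \<open>d * e\<close> for the generator of \<open>S\<close>. The leading
  \<open>d\<close> counts the extensions of \<open>J\<close> and accounts for the \<open>- 1\<close>
  in the new exponent.\<close>

lemma const_gen_mult_zeta_weight:
  fixes d k e :: nat and s u :: complex
  assumes "d > 0"
  shows "of_nat d * (of_nat (d * e * k) powr (- s) * of_nat (d * e) powr (- u)) =
    of_nat k powr (- s) * of_nat d powr (- (s + u - 1)) * of_nat e powr (- (s + u))"
proof -
  have "of_nat d * of_nat d powr (- s) * of_nat d powr (- u) = (of_nat d powr (1 + - s + - u) :: complex)"
    using assms by (simp only: powr_add powr_to_1)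
  also have "1 + - s + - u = - (s + u - 1)" by simp
  finally have 1: "of_nat d * of_nat d powr (- s) * of_nat d powr (- u) = (of_nat d powr (- (s + u - 1)) :: complex)" .
  have 2: "of_nat e powr (- s) * of_nat e powr (- u) = (of_nat e powr (- (s + u)) :: complex)"
    by (simp flip: powr_add)
  show ?thesis
    unfolding of_nat_mult_powr 1[symmetric] 2[symmetric] by (simp only: mult_ac)
qed

text \<open>Grouping the ideals by \<open>(J, e)\<close> gives fibres of size
  \<open>const_gen J\<close>. Weighted by that size, the summand splits into a weight of
  \<open>J\<close> and \<open>e powr (- (s + u))\<close>, so the sum is a product of two absolutely
  convergent series.\<close>

lemma has_sum_zeta_weight_Suc:
  assumes su: "Re (s + u) > 1"
    and abs: "zeta_weight s (s + u - 1) abs_summable_on trunc_ideals n"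
    and sum: "(zeta_weight s (s + u - 1) has_sum z) (trunc_ideals n)"
  shows "zeta_weight s u abs_summable_on trunc_ideals (Suc n)"
    and "(zeta_weight s u has_sum z * riemann_zeta (s + u)) (trunc_ideals (Suc n))"
proof -
  define p where "p S = (colon_X S, const_gen S div const_gen (colon_X S))" for S
  define G where "G = (\<lambda>(J, e). of_nat (const_gen J * e * ideal_index J) powr (- s) *
    of_nat (const_gen J * e) powr (- u) :: complex)"
  let ?A = "trunc_ideals (Suc n)" and ?B = "trunc_ideals n \<times> {0::nat<..}"
  let ?F = "\<lambda>(J, e). zeta_weight s (s + u - 1) J * of_nat e powr (- (s + u))"
  have p_in: "p S \<in> ?B" if "S \<in> ?A" for S
    using colon_X_trunc_ideals[OF that] const_gen_colon_X_dvd[OF that] const_gen_trunc_pos[OF that]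
      const_gen_trunc_pos[OF colon_X_trunc_ideals[OF that]]
    by (auto simp: p_def dvd_def)
  have fibre: "{S \<in> ?A. p S = (J, e)} = {S \<in> ?A. colon_X S = J \<and> const_gen S = const_gen J * e}"
    if "J \<in> trunc_ideals n" for J e
    using const_gen_colon_X_dvd[of _ n] const_gen_trunc_pos[OF that] by (auto simp: p_def)
  have card: "card {S \<in> ?A. p S = y} = const_gen (fst y)" if "y \<in> ?B" for y
    using that fibre card_extensions by auto
  \<comment> \<open>A positive \<open>card\<close> rules out an infinite fibre.\<close>
  have fin: "finite {S \<in> ?A. p S = y}" if "y \<in> ?B" for y
    using card[OF that] const_gen_trunc_pos[of "fst y" n] that by (intro card_ge_0_finite) auto
  have FG: "of_nat (card {S \<in> ?A. p S = y}) * G y = ?F y" if "y \<in> ?B" for y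
  proof -
    obtain J e where y: "y = (J, e)" by (cases y)
    show ?thesis
      unfolding card[OF that] using that const_gen_mult_zeta_weight[OF const_gen_trunc_pos, of J n]
      by (simp add: y G_def zeta_weight_def)
  qed
  have wG: "zeta_weight s u S = G (p S)" if "S \<in> ?A" for S
    unfolding zeta_weight_def G_def p_def prod.case
      dvd_mult_div_cancel[OF const_gen_colon_X_dvd[OF that]] ideal_index_trunc_Suc[OF that] ..
  note F = has_sum_Times_mult[OF abs has_sum_riemann_zeta(1)[OF su] sum has_sum_riemann_zeta(2)[OF su]]
  have "(\<lambda>y. of_nat (card {S \<in> ?A. p S = y}) * norm (G y)) summable_on ?B"
  proof (rule summable_on_cong[THEN iffD1, OF _ F(1)])
    fix y assume "y \<in> ?B"
    from FG[OF this, symmetric] show "norm (?F y) = of_nat (card {S \<in> ?A. p S = y}) * norm (G y)"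
      by (simp only: norm_mult norm_of_nat)
  qed
  moreover have "((\<lambda>y. \<Sum>x\<in>{S \<in> ?A. p S = y}. G y) has_sum z * riemann_zeta (s + u)) ?B"
  proof (rule has_sum_cong[THEN iffD1, OF _ F(2)])
    fix y assume "y \<in> ?B"
    from FG[OF this, symmetric] show "?F y = (\<Sum>x\<in>{S \<in> ?A. p S = y}. G y)"
      by (simp only: sum_constant)
  qed
  ultimately have *: "(\<lambda>S. G (p S)) abs_summable_on ?A"
     "((\<lambda>S. G (p S)) has_sum z * riemann_zeta (s + u)) ?A"
    using has_sum_fibres[of ?A p ?B G, OF p_in fin] by auto
  show "zeta_weight s u abs_summable_on ?A"
    by (rule summable_on_cong[THEN iffD1, OF _ *(1)]) (simp add: wG)
  show "(zeta_weight s u has_sum z * riemann_zeta (s + u)) ?A"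
    by (rule has_sum_cong[THEN iffD1, OF _ *(2)]) (simp add: wG)
qed

text \<open>Induction on \<open>n\<close> with \<open>u\<close> general, because the recursion
  replaces \<open>u\<close> by \<open>s + u - 1\<close>; its real part stays nonnegative thanks to
  \<open>Re s > 1\<close>.\<close>

lemma has_sum_zeta_weight:
  assumes s: "Re s > 1" and "Re u \<ge> 0"
  shows "zeta_weight s u abs_summable_on trunc_ideals n \<and>
    (zeta_weight s u has_sum (\<Prod>j = 1..n. riemann_zeta (of_nat j * s - (of_nat j - 1) + u))) (trunc_ideals n)"
  using assms(2)
proof (induction n arbitrary: u)
  case 0
  have "zeta_weight s u UNIV = 1" by (simp add: zeta_weight_def ideal_index_UNIV const_gen_UNIV)
  then show ?case by (auto simp: trunc_ideals_0 intro!: has_sum_finiteI)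
next
  case (Suc n)
  have "Re (s + u - 1) \<ge> 0" using Suc.prems s by simp
  note IH = Suc.IH[OF this]
  have "(\<Prod>j = 1..Suc n. riemann_zeta (of_nat j * s - (of_nat j - 1) + u)) =
    riemann_zeta (s + u) * (\<Prod>j = Suc 1..Suc n. riemann_zeta (of_nat j * s - (of_nat j - 1) + u))"
    by (subst prod.atLeast_Suc_atMost) auto
  \<comment> \<open>Factor \<open>j + 1\<close> at \<open>u\<close> equals factor \<open>j\<close>
    at \<open>s + u - 1\<close>:
    \<open>(j + 1) s - j + u = j s - (j - 1) + (s + u - 1)\<close>.\<close>
  also have "(\<Prod>j = Suc 1..Suc n. riemann_zeta (of_nat j * s - (of_nat j - 1) + u)) =
    (\<Prod>j = 1..n. riemann_zeta (of_nat j * s - (of_nat j - 1) + (s + u - 1)))"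
    unfolding prod.shift_bounds_cl_Suc_ivl by (intro prod.cong refl arg_cong[of _ _ riemann_zeta]) (simp add: algebra_simps)
  finally have prod: "(\<Prod>j = 1..Suc n. riemann_zeta (of_nat j * s - (of_nat j - 1) + u)) =
    (\<Prod>j = 1..n. riemann_zeta (of_nat j * s - (of_nat j - 1) + (s + u - 1))) * riemann_zeta (s + u)"
    by (simp only: mult.commute)
  have su: "Re (s + u) > 1" using Suc.prems s by simp
  show ?case
    unfolding prod using has_sum_zeta_weight_Suc[OF su IH[THEN conjunct1] IH[THEN conjunct2]] ..
qed

section \<open>From sums over ideals to Dirichlet series\<close>

lemma finite_trunc_ideals_index:
  assumes "k > 0"
  shows "finite {S \<in> trunc_ideals n. ideal_index S = k}"
  \<comment> \<open>Infinitely many ideals of index \<open>k\<close> would make the convergent series at \<open>s = 2\<close> diverge.\<close>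
proof (rule ccontr)
  let ?A = "{S \<in> trunc_ideals n. ideal_index S = k}"
  assume inf: "infinite ?A"
  have "zeta_weight 2 0 abs_summable_on trunc_ideals n" using has_sum_zeta_weight[of 2 0] by simp
  then have "zeta_weight 2 0 abs_summable_on ?A" by (rule summable_on_subset_banach) auto
  then have "(\<lambda>_. norm (of_nat k powr (-2) :: complex)) summable_on ?A"
    by (rule summable_on_cong[THEN iffD1, rotated])
       (auto simp: zeta_weight_def dest: const_gen_trunc_pos)
  moreover have "norm (of_nat k powr (-2) :: complex) \<noteq> 0" using assms by simp
  ultimately show False using infsum_diverge_constant[OF inf] by blast
qed

text \<open>At \<open>u = 0\<close> the weight depends on the index alone, so collecting ideals of
  equal index turns the sum over ideals into a Dirichlet series.\<close>

lemma sums_trunc_ideals: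
  fixes n :: nat
  assumes s: "Re s > 1"
  defines "a \<equiv> \<lambda>k. of_nat (card {S \<in> trunc_ideals n. ideal_index S = Suc k}) * of_nat (Suc k) powr (- s) :: complex"
  shows "summable (\<lambda>k. norm (a k))"
    and "a sums (\<Prod>j = 1..n. riemann_zeta (of_nat j * s - (of_nat j - 1)))"
proof -
  define f where "f k = (of_nat (Suc k) powr (- s) :: complex)" for k
  let ?z = "\<Prod>j = 1..n. riemann_zeta (of_nat j * s - (of_nat j - 1))"
  let ?T = "trunc_ideals n"
  \<comment> \<open>The shift by one matches the series indexed by \<open>Suc k\<close>; indices are
    positive, so the natural-number subtraction is exact.\<close>
  let ?A = "\<lambda>k. {S \<in> ?T. ideal_index S - 1 = k}"
  have A: "?A k = {S \<in> ?T. ideal_index S = Suc k}" for k by (auto simp: trunc_ideals_def)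
  have fin: "finite (?A k)" for k unfolding A by (rule finite_trunc_ideals_index) simp
  have w: "zeta_weight s 0 S = f (ideal_index S - 1)" if "S \<in> ?T" for S
    using that const_gen_trunc_pos[OF that] by (simp add: zeta_weight_def f_def trunc_ideals_def)
  have W: "zeta_weight s 0 abs_summable_on ?T" "(zeta_weight s 0 has_sum ?z) ?T"
    using has_sum_zeta_weight[OF s, of 0 n] by auto
  have bij: "bij_betw snd (Sigma UNIV ?A) ?T" by (rule bij_betw_snd_fibres) simp
  have abs: "(\<lambda>kS. norm (zeta_weight s 0 (snd kS))) summable_on Sigma UNIV ?A"
    using summable_on_reindex_bij_betw[OF bij, where f = "\<lambda>S. norm (zeta_weight s 0 S)"] W(1) by simp
  obtain c where c: "((\<lambda>kS. norm (zeta_weight s 0 (snd kS))) has_sum c) (Sigma UNIV ?A)"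
    using abs by (auto simp: summable_on_def)
  \<comment> \<open>All ideals of one index have the same weight, so no cancellation occurs and
    \<open>norm (a k)\<close> is the sum of their norms.\<close>
  have "((\<lambda>k. norm (a k)) has_sum c) UNIV"
  proof (rule has_sum_SigmaD[OF c])
    fix k
    show "((\<lambda>S. norm (zeta_weight s 0 (snd (k, S)))) has_sum norm (a k)) (?A k)"
      using fin[of k] by (intro has_sum_finiteI) (auto simp: a_def w norm_mult f_def A[unfolded One_nat_def] simp del: of_nat_Suc)
  qed
  then show "summable (\<lambda>k. norm (a k))" by (auto dest: has_sum_imp_sums simp: sums_iff)
  have "((\<lambda>kS. zeta_weight s 0 (snd kS)) has_sum ?z) (Sigma UNIV ?A)"
    using has_sum_reindex_bij_betw[OF bij, where f = "zeta_weight s 0"] W(2) by simp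
  then have "(a has_sum ?z) UNIV"
  proof (rule has_sum_SigmaD)
    fix k
    show "((\<lambda>S. zeta_weight s 0 (snd (k, S))) has_sum a k) (?A k)"
      using fin[of k] by (intro has_sum_finiteI) (auto simp: a_def w f_def A[unfolded One_nat_def] simp del: of_nat_Suc)
  qed
  then show "a sums ?z" by (rule has_sum_imp_sums)
qed

subsection \<open>Transfer to the quotient ring\<close>

text \<open>The correspondence theorem: preimage and image under \<open>\<pi>\<close> are inverse
  bijections between the ideals of \<open>R\<close> and the ideals containing the kernel, and they
  preserve the index.\<close>

lemma ideal_count_via_surjection:
  fixes \<pi> :: "'b::comm_ring_1 \<Rightarrow> 'a" and R (structure)
  assumes R: "ring R"
    and surj: "range \<pi> = carrier R"
    and add: "\<And>x y. \<pi> (x + y) = \<pi> x \<oplus> \<pi> y"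
    and mult: "\<And>x y. \<pi> (x * y) = \<pi> x \<otimes> \<pi> y"
  shows "ideal_count R k = card {S. is_ideal S \<and> {x. \<pi> x = \<zero>} \<subseteq> S \<and> ideal_index S = k}"
proof -
  interpret ring R by fact
  have carr [simp]: "\<pi> x \<in> carrier R" for x using surj by auto
  have ex: "a \<in> carrier R \<Longrightarrow> \<exists>x. a = \<pi> x" for a using surj by auto
  have zero: "\<pi> 0 = \<zero>"
    using add[of 0 0] add.l_cancel_one'[of "\<pi> 0" "\<pi> 0"] by simp
  have uminus: "\<pi> (- x) = \<ominus> \<pi> x" for x
    using add[of "- x" x] zero by (simp add: minus_equality)
  have diff: "\<pi> (x - y) = \<pi> x \<ominus> \<pi> y" for x y
    using add[of x "- y"] by (simp add: uminus a_minus_def)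
  have index: "card (a_rcosets J) = ideal_index (\<pi> -` J)" and vimage: "is_ideal (\<pi> -` J)"
    and ker: "{x. \<pi> x = \<zero>} \<subseteq> \<pi> -` J" and image: "\<pi> ` (\<pi> -` J) = J" if "ideal J R" for J
  proof -
    interpret J: ideal J R by fact
    show id: "is_ideal (\<pi> -` J)"
      by (auto simp: is_ideal_def zero add mult J.I_l_closed)
    show "{x. \<pi> x = \<zero>} \<subseteq> \<pi> -` J" by auto
    show "\<pi> ` (\<pi> -` J) = J" using surj J.a_subset by auto
    have "a_rcosets J = range (\<lambda>x. J +> \<pi> x)"
      by (auto simp: A_RCOSETS_def' surj[symmetric])
    moreover have "J +> \<pi> x = J +> \<pi> y \<longleftrightarrow> residue_class (\<pi> -` J) x = residue_class (\<pi> -` J) y" for x y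
    proof -
      have "J +> \<pi> x = J +> \<pi> y \<longleftrightarrow> \<pi> x \<in> J +> \<pi> y"
        using J.a_repr_independence'[OF _ carr] J.a_rcos_self[OF carr] by metis
      also have "\<dots> \<longleftrightarrow> \<pi> (x - y) \<in> J"
        using J.a_rcos_module_minus[OF ring_axioms, of "\<pi> y" "\<pi> x"] by (simp add: diff)
      finally show ?thesis by (simp add: residue_class_eq_iff[OF id])
    qed
    ultimately show "card (a_rcosets J) = ideal_index (\<pi> -` J)"
      unfolding ideal_index_def by (simp only:) (rule card_image_eq_if_same_fibres)
  qed
  have img: "ideal (\<pi> ` S) R" "\<pi> -` (\<pi> ` S) = S"
    if S: "is_ideal S" "{x. \<pi> x = \<zero>} \<subseteq> S" for S
  proof -
    show "ideal (\<pi> ` S) R"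
    proof (rule idealI)
      show "subgroup (\<pi> ` S) (add_monoid R)"
      proof (rule add.subgroupI)
        show "\<pi> ` S \<noteq> {}" using is_ideal_zero[OF S(1)] by auto
      next
        fix a assume "a \<in> \<pi> ` S"
        then obtain x where "x \<in> S" "a = \<pi> x" by auto
        then show "\<ominus> a \<in> \<pi> ` S"
          using is_ideal_uminus[OF S(1)] by (auto simp flip: uminus)
      next
        fix a b assume "a \<in> \<pi> ` S" "b \<in> \<pi> ` S"
        then show "a \<oplus> b \<in> \<pi> ` S" using is_ideal_add[OF S(1)] by (auto simp flip: add)
      qed auto
    next
      fix a x assume "a \<in> \<pi> ` S" "x \<in> carrier R"
      then obtain s y where s: "s \<in> S" "a = \<pi> s" "x = \<pi> y" using ex by blast
      \<comment> \<open>Two-sided absorption comes from commutativity in the source of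
        \<open>\<pi>\<close>.\<close>
      then show "x \<otimes> a \<in> \<pi> ` S" "a \<otimes> x \<in> \<pi> ` S"
        using is_ideal_mult[OF S(1), of s y] by (auto simp: mult.commute simp flip: mult)
    qed (rule ring_axioms)
    show "\<pi> -` (\<pi> ` S) = S"
    proof safe
      fix x y assume y: "y \<in> S" and eq: "\<pi> x = \<pi> y"
      \<comment> \<open>Containment of the kernel in \<open>S\<close> is what makes \<open>S\<close>
        saturated.\<close>
      have "\<pi> (x - y) = \<zero>" unfolding diff eq by (simp add: a_minus_def r_neg)
      then have "x - y \<in> S" using S(2) by auto
      then show "x \<in> S" using is_ideal_add[OF S(1) _ y] by force
    qed auto
  qed
  have "bij_betw (\<lambda>J. \<pi> -` J) {J. ideal J R \<and> card (a_rcosets J) = k}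
    {S. is_ideal S \<and> {x. \<pi> x = \<zero>} \<subseteq> S \<and> ideal_index S = k}"
  proof (rule bij_betw_byWitness[where f' = "\<lambda>S. \<pi> ` S"])
    show "\<forall>J\<in>{J. ideal J R \<and> card (a_rcosets J) = k}. \<pi> ` (\<pi> -` J) = J"
      using image by blast
    show "\<forall>S\<in>{S. is_ideal S \<and> {x. \<pi> x = \<zero>} \<subseteq> S \<and> ideal_index S = k}. \<pi> -` (\<pi> ` S) = S"
      using img(2) by blast
    show "(\<lambda>J. \<pi> -` J) ` {J. ideal J R \<and> card (a_rcosets J) = k}
      \<subseteq> {S. is_ideal S \<and> {x. \<pi> x = \<zero>} \<subseteq> S \<and> ideal_index S = k}"
    proof (intro image_subsetI CollectI conjI; elim CollectE conjE)
      fix J assume J: "ideal J R" "card (a_rcosets J) = k"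
      show "is_ideal (\<pi> -` J)" "{x. \<pi> x = \<zero>} \<subseteq> \<pi> -` J" by (rule vimage[OF J(1)], rule ker[OF J(1)])
      show "ideal_index (\<pi> -` J) = k" using index[OF J(1)] J(2) by simp
    qed
    show "(\<lambda>S. \<pi> ` S) ` {S. is_ideal S \<and> {x. \<pi> x = \<zero>} \<subseteq> S \<and> ideal_index S = k}
      \<subseteq> {J. ideal J R \<and> card (a_rcosets J) = k}"
    proof (intro image_subsetI CollectI conjI; elim CollectE conjE)
      fix S assume S: "is_ideal S" "{x. \<pi> x = \<zero>} \<subseteq> S" "ideal_index S = k"
      show "ideal (\<pi> ` S) R" by (rule img(1)[OF S(1,2)])
      then show "card (a_rcosets (\<pi> ` S)) = k" using index img(2)[OF S(1,2)] S(3) by simp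
    qed
  qed
  then show ?thesis unfolding ideal_count_def by (rule bij_betw_same_card)
qed

section \<open>Identification of \<open>int poly\<close> with the eventually zero sequences forming
  \<open>UP \<Z>\<close>\<close>

lemma range_coeff: "range coeff = carrier (UP \<Z>)"
proof safe
  fix p :: "int poly"
  have "bound 0 (degree p) (coeff p)" by (rule bound.intro) (rule coeff_eq_0)
  then show "coeff p \<in> carrier (UP \<Z>)" by (auto simp: UP_def up_def)
next
  fix f assume "f \<in> carrier (UP \<Z>)"
  then obtain n where "bound 0 n f" by (auto simp: UP_def up_def)
  then have "coeff (Abs_poly f) = f"
    by (intro coeff_Abs_poly[of n]) (auto simp: bound_def)
  then show "f \<in> range coeff" by (metis rangeI)
qed

lemma coeff_in_UP: "coeff p \<in> carrier (UP \<Z>)"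
  using range_coeff by auto

lemma coeff_add_UP: "coeff (p + q) = coeff p \<oplus>\<^bsub>UP \<Z>\<^esub> coeff q"
  using coeff_in_UP[of p] coeff_in_UP[of q] by (auto simp: UP_def)

lemma coeff_mult_UP: "coeff (p * q) = coeff p \<otimes>\<^bsub>UP \<Z>\<^esub> coeff q"
  using coeff_in_UP[of p] coeff_in_UP[of q]
  by (auto simp: UP_def coeff_mult int_finsum_eq)

lemma coeff_monom_UP: "coeff (monom 1 n) = up_ring.monom (UP \<Z>) 1 n"
  by (auto simp: UP_def)

lemma cring_UP_int: "cring (UP \<Z>)"
  by (rule UP_cring.UP_cring) (simp add: UP_cring_def int_is_cring)

text \<open>The correspondence is applied to \<open>coeff\<close> followed by the quotient map. The
  kernel consists of the multiples of \<open>X^n\<close>, and an ideal contains it exactly when it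
  contains \<open>X^n\<close>.\<close>

lemma ideal_count_truncated_poly_ring:
  "ideal_count (truncated_poly_ring n) k =
    card {S :: int poly set. is_ideal S \<and> monom 1 n \<in> S \<and> ideal_index S = k}"
proof -
  let ?P = "UP \<Z>" and ?X = "coeff (monom (1::int) n)"
  interpret P: cring ?P by (rule cring_UP_int)
  define K where "K = PIdl\<^bsub>?P\<^esub> ?X"
  interpret K: ideal K ?P unfolding K_def by (intro P.cgenideal_ideal coeff_in_UP)
  let ?\<pi> = "\<lambda>p. K +>\<^bsub>?P\<^esub> coeff p"
  have T: "truncated_poly_ring n = ?P Quot K"
    by (simp add: truncated_poly_ring_def K_def coeff_monom_UP)
  have hom: "(+>\<^bsub>?P\<^esub>) K \<in> ring_hom ?P (?P Quot K)" by (rule K.rcos_ring_hom)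
  have ker: "?\<pi> p = \<zero>\<^bsub>?P Quot K\<^esub> \<longleftrightarrow> monom 1 n dvd p" for p
  proof -
    have "?\<pi> p = \<zero>\<^bsub>?P Quot K\<^esub> \<longleftrightarrow> coeff p \<in> K"
      using K.a_rcos_const[of "coeff p"] K.rcos_const_imp_mem[OF coeff_in_UP] by (auto simp: FactRing_def)
    also have "\<dots> \<longleftrightarrow> (\<exists>q. coeff p = coeff q \<otimes>\<^bsub>?P\<^esub> ?X)"
      unfolding K_def cgenideal_def range_coeff[symmetric] by auto
    also have "\<dots> \<longleftrightarrow> monom 1 n dvd p"
      unfolding coeff_mult_UP[symmetric] coeff_inject dvd_def by (simp add: mult.commute)
    finally show ?thesis .
  qed
  have "ideal_count (?P Quot K) k =
      card {S. is_ideal S \<and> {p. ?\<pi> p = \<zero>\<^bsub>?P Quot K\<^esub>} \<subseteq> S \<and> ideal_index S = k}"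
  proof (rule ideal_count_via_surjection)
    show "ring (?P Quot K)" by (rule K.quotient_is_ring)
    show "range ?\<pi> = carrier (?P Quot K)"
      by (auto simp: FactRing_def A_RCOSETS_def' simp flip: range_coeff)
  qed (simp_all add: coeff_add_UP coeff_mult_UP coeff_in_UP ring_hom_add[OF hom] ring_hom_mult[OF hom])
  also have "{S. is_ideal S \<and> {p. ?\<pi> p = \<zero>\<^bsub>?P Quot K\<^esub>} \<subseteq> S \<and> ideal_index S = k} =
      {S. is_ideal S \<and> monom 1 n \<in> S \<and> ideal_index S = k}"
    unfolding ker by (auto simp: dvd_def mult.commute intro: is_ideal_mult)
  finally show ?thesis unfolding T .
qed

theorem theorem1:
  fixes n :: nat and s :: complex
  assumes "n \<ge> 1" and "Re s > 1"
  shows "summable (\<lambda>k. norm (ideal_zeta_term (truncated_poly_ring n) s (Suc k))) \<and>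
    ideal_zeta (truncated_poly_ring n) s =
      (\<Prod>j = 1..n. riemann_zeta (of_nat j * s - (of_nat j - 1)))"
proof -
  \<comment> \<open>Index \<open>Suc k\<close> already implies finite index.\<close>
  have "{S :: int poly set. is_ideal S \<and> monom 1 n \<in> S \<and> ideal_index S = Suc k} =
      {S \<in> trunc_ideals n. ideal_index S = Suc k}" for k
    by (auto simp: trunc_ideals_def)
  then show ?thesis
    using sums_trunc_ideals[OF assms(2), of n]
    unfolding ideal_zeta_def ideal_zeta_term_def ideal_count_truncated_poly_ring by (simp add: sums_iff)
qed

end
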